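(* Let $m,d$ be natural numbers with $d\geqslant m+2$, and let $\varepsilon,c,C$ be positive constants. For each natural number $N$ let $L=L(N):\mathbb{R}^d\to\mathbb{R}^m$ be a linear map with $\Vert L\Vert_\infty\leqslant C$. Let $F:\mathbb{R}^d\to[0,1]$ be the indicator function of $[1,N]^d$ and $G:\mathbb{R}^m\to[0,1]$ the indicator function of $[-\varepsilon,\varepsilon]^m$. Assume that $\operatorname{dist}(L,V_{\mathrm{rank}}(m,d))\geqslant c$ and that $T^L_{F,G,N}(1,\dots,1)\gg_{c,C,\varepsilon}1$ for all large enough $N$. Suppose that $\liminf_{N\to\infty}\operatorname{dist}(L,V^*_{\mathrm{degen}}(m,d))=0$. Let $s$ be a natural number, let $H:\mathbb{R}_{>0}\to\mathbb{R}_{>0}$ be any function with $H(\rho)\to0$ as $\rho\to0$, and let $E_\rho(N)$ be an error term depending on a parameter $\rho$ with $E_\rho(N)\to0$ as $N\to\infty$ for each fixed $\rho$. Then there are infinitely many natural numbers $N$ for which there exist functions $f_1,\dots,f_d:[N]\to[-1,1]$ and some $\rho\leqslant1$ such that both $\min_j\Vert f_j\Vert_{U^{s+1}[N]}\leqslant\rho$ and $$|T^L_{F,G,N}(f_1,\dots,f_d)|>H(\rho)+E_\rho(N).$$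
   Context: Linear maps $\mathbb{R}^a\to\mathbb{R}^b$ are identified with their matrices; $\Vert L\Vert_\infty$ is the maximum absolute value of the entries; $\operatorname{dist}(X,Y)=\inf\Vert x-y\Vert_\infty$ over $x\in X,y\in Y$ (entries as coordinates). $V_{\mathrm{rank}}(m,d)$ is the set of $m\times d$ real matrices of rank less than $m$. $V^*_{\mathrm{degen}}(m,d)$ is the set of linear maps $L:\mathbb{R}^d\to\mathbb{R}^m$ for which there exist $i,j\leqslant d$ and $\lambda\in\mathbb{R}$ with $\mathbf e_i^*-\lambda\mathbf e_j^*\neq0$ and $\mathbf e_i^*-\lambda\mathbf e_j^*\in L^*((\mathbb{R}^m)^* )$ (equivalently, the row space of $L$ contains a non-zero vector with at most two non-zero coordinates). $X\gg_{c,C,\varepsilon}1$ means $X\geqslant K^{-1}$ for a constant $K$ depending on $c,C,\varepsilon,m,d$. $[N]=\{1,\dots,N\}$; the function $1$ denotes the constant function $1$ on $[N]$. Solution count: for $F$ supported on $[-N,N]^d$, compactly supported $G$, and $f_j:[N]\to[-1,1]$ extended by zero to $\mathbb{Z}$, $T^L_{F,G,N}(f_1,\dots,f_d)=N^{-(d-m)}\sum_{\mathbf n\in\mathbb{Z}^d}\prod_j f_j(n_j)F(\mathbf n)G(L\mathbf n)$. Gowers norm: for $g:\mathbb{Z}/N'\mathbb{Z}\to\mathbb{C}$, $\Vert g\Vert_{U^k(N')}^{2^k}=N'^{-(k+1)}\sum_{x,h_1,\dots,h_k}\prod_{\boldsymbol\omega\in\{0,1\}^k}\mathcal C^{|\boldsymbol\omega|}g(x+\mathbf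 h\cdot\boldsymbol\omega)$; for $f:[N]\to\mathbb{C}$, $\Vert f\Vert_{U^k[N]}=\Vert f1_{[N]}\Vert_{U^k(N')}/\Vert1_{[N]}\Vert_{U^k(N')}$ with $[N]\subseteq\mathbb{Z}/N'\mathbb{Z}$ and $N'/N$ sufficiently large in terms of $k$. *)

theory Defs
  imports "HOL-Analysis.Analysis" "HOL-Library.Liminf_Limsup"
begin

definition mat_linf :: "real^'d^'m \<Rightarrow> real" where
  "mat_linf A = Max {\<bar>A $ i $ j\<bar> | i j. True}"

definition mat_dist :: "real^'d^'m \<Rightarrow> (real^'d^'m) set \<Rightarrow> real" where
  "mat_dist A S = Inf ((\<lambda>B. mat_linf (A - B)) ` S)"

definition V_rank :: "(real^'d^'m) set" where
  "V_rank = {A. rank A < CARD('m)}"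

text \<open>V*_degen(m,d): some e_i^* - lambda e_j^* (nonzero) lies in the image of the dual map L^*,
  i.e. in the range of the transpose matrix (the row space).\<close>
definition V_degen :: "(real^'d^'m) set" where
  "V_degen = {L. \<exists>i j (lam::real). axis i 1 - lam *\<^sub>R axis j 1 \<noteq> (0::real^'d) \<and>
                   axis i 1 - lam *\<^sub>R axis j 1 \<in> range (\<lambda>y. transpose L *v y)}"

definition real_ivec :: "int^'d \<Rightarrow> real^'d" where
  "real_ivec n = (\<chi> j. real_of_int (n $ j))"

text \<open>Solution count T^L_{F,G,N}(f_1,...,f_d), with F supported on [-N,N]^d (so the sum over Z^d
  reduces to the finite box) and each f_j : [N] -> R extended by zero to Z.\<close>
definition sol_count ::
  "(real^'d \<Rightarrow> real) \<Rightarrow> (real^'m \<Rightarrow> real) \<Rightarrow> real^'d^'m \<Rightarrow> nat \<Rightarrow> ('d \<Rightarrow> int \<Rightarrow> real) \<Rightarrow> real" where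
  "sol_count F G L N f =
     (1 / real N ^ (CARD('d) - CARD('m))) *
     (\<Sum>n\<in>{n::int^'d. \<forall>j. \<bar>n $ j\<bar> \<le> int N}.
        (\<Prod>j\<in>UNIV. (if 1 \<le> n $ j \<and> n $ j \<le> int N then f j (n $ j) else 0))
        * F (real_ivec n) * G (L *v real_ivec n))"

text \<open>Gowers U^k norm on Z/N'Z of a real-valued function g (given on representatives 0..N'-1;
  conjugation is the identity for real-valued functions). The cube coordinate vector
  omega in {0,1}^k is encoded as the subset S of {0..k-1} where omega is 1.\<close>
definition gowers_cyc :: "nat \<Rightarrow> nat \<Rightarrow> (int \<Rightarrow> real) \<Rightarrow> real" where
  "gowers_cyc k N' g =
     ((1 / real N' ^ (k + 1)) *
      (\<Sum>x\<in>{0..<int N'}. \<Sum>h\<in>PiE {..<k} (\<lambda>_. {0..<int N'}).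
          \<Prod>S\<in>Pow {..<k}. g ((x + (\<Sum>i\<in>S. h i)) mod int N'))) powr (1 / 2 ^ k)"

text \<open>Gowers U^k[N] norm of f : [N] -> R: embed [N] into Z/N'Z with N' = 2^(k+1) N
  (large enough in terms of k that the normalised value does not depend on N').\<close>
definition gowers_interval :: "nat \<Rightarrow> nat \<Rightarrow> (int \<Rightarrow> real) \<Rightarrow> real" where
  "gowers_interval k N f =
     gowers_cyc k (2 ^ (k + 1) * N) (\<lambda>x. if 1 \<le> x \<and> x \<le> int N then f x else 0)
     / gowers_cyc k (2 ^ (k + 1) * N) (\<lambda>x. if 1 \<le> x \<and> x \<le> int N then 1 else 0)"

end

theory Submission
  imports Defs
begin

text \<open>If \<open>L\<close> is close to a degenerate matrix, then its row space almost contains some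
  \<open>e\<^sub>i - \<lambda> e\<^sub>j\<close> with \<open>i \<noteq> j\<close> and \<open>\<bar>\<lambda>\<bar> \<le> 1\<close>, so in every counted solution \<open>n\<close> the
  coordinate \<open>n\<^sub>i\<close> lies in a short window determined by \<open>n\<^sub>j\<close>. Cut \<open>[N]\<close> into blocks of length
  \<open>l = \<beta> N\<close>, not shorter than the window: the block of \<open>n\<^sub>i\<close> is then \<open>b(n\<^sub>j)\<close> or \<open>b(n\<^sub>j) + 1\<close>, and
  one of the two choices accounts for half of the solutions. Attach random signs to the blocks, let
  \<open>f\<^sub>i\<close> be the sign of the block of its argument, \<open>f\<^sub>j\<close> the sign of the block chosen for \<open>n\<^sub>i\<close>, and
  all other functions \<open>1\<close>. The expected solution count is at least half of that of the constant
  functions, while the expected Gowers average of \<open>f\<^sub>i\<close> is at most the proportion of cubes whose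
  base vertex shares its block with another vertex, which is \<open>O(\<beta>)\<close>. So some choice of signs makes the solution count
  large and the Gowers norm small.\<close>

section \<open>Gowers sums modulo \<open>M\<close>: positivity and counting of cube vertices\<close>

text \<open>Averaging over random signs commutes with this raw sum but not with the root in
  \<open>gowers_cyc\<close>, so the probabilistic argument is carried out before
  normalisation.\<close>

definition gowers_sum :: "nat \<Rightarrow> nat \<Rightarrow> (int \<Rightarrow> real) \<Rightarrow> real" where
  "gowers_sum k M g =
     (\<Sum>x\<in>{0..<int M}. \<Sum>h\<in>PiE {..<k} (\<lambda>_. {0..<int M}).
          \<Prod>S\<in>Pow {..<k}. g ((x + (\<Sum>i\<in>S. h i)) mod int M))"

lemma gowers_cyc_eq: "gowers_cyc k M g = (gowers_sum k M g / real M ^ (k + 1)) powr (1 / 2 ^ k)"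
  by (simp add: gowers_cyc_def gowers_sum_def)

lemma sum_PiE_insert:
  assumes "i \<notin> I"
  shows "(\<Sum>h\<in>PiE (insert i I) T. F h) = (\<Sum>h\<in>PiE I T. \<Sum>y\<in>T i. F (h(i := y)))"
proof -
  have "(\<Sum>h\<in>PiE (insert i I) T. F h) = (\<Sum>(y, h)\<in>T i \<times> PiE I T. F (h(i := y)))"
    unfolding PiE_insert_eq
    by (subst sum.reindex[OF inj_combinator[OF assms]]) (simp add: case_prod_unfold)
  also have "\<dots> = (\<Sum>y\<in>T i. \<Sum>h\<in>PiE I T. F (h(i := y)))"
    by (simp add: sum.cartesian_product)
  finally show ?thesis by (subst sum.swap)
qed

lemma sum_of_bool_card:
  assumes "finite A"
  shows "(\<Sum>x\<in>A. of_bool (P x) :: real) = real (card {x \<in> A. P x})"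
  using assms by (simp add: of_bool_def flip: sum.inter_filter)

lemma bij_betw_add_mod:
  assumes "0 < M"
  shows "bij_betw (\<lambda>y. (a + y) mod M) {0..<M} {0..<M::int}"
proof -
  have "(y - a) mod M = y'" if "y = (a + y') mod M" "0 \<le> y'" "y' < M" for y y'
    using that by (simp add: mod_diff_left_eq)
  moreover have "(a + (y - a) mod M) mod M = y" if "0 \<le> y" "y < M" for y
    using that by (simp add: mod_add_right_eq)
  ultimately show ?thesis using assms
    by (intro bij_betwI[where g = "\<lambda>y. (y - a) mod M"]) auto
qed

text \<open>Splitting off the last direction pairs each \<open>k\<close>-dimensional cube with its
  translate by \<open>y\<close>. As \<open>P h\<close> is periodic modulo \<open>M\<close>, summing
  over \<open>x\<close> and \<open>y\<close> gives, for every \<open>h\<close>, the square of a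
  single sum.\<close>

lemma gowers_sum_nonneg:
  assumes "0 < M"
  shows "0 \<le> gowers_sum (Suc k) M g"
proof -
  define P where "P h x = (\<Prod>S\<in>Pow {..<k}. g ((x + (\<Sum>i\<in>S. h i)) mod int M))" for h :: "nat \<Rightarrow> int" and x
  have P_mod: "P h (x mod int M) = P h x" for h x
    by (simp add: P_def mod_add_left_eq)
  have split: "(\<Prod>S\<in>Pow {..<Suc k}. g ((x + (\<Sum>i\<in>S. (h(k := y)) i)) mod int M))
      = P h x * P h (x + y)" for h x y
  proof -
    have *: "(\<Sum>i\<in>S. (h(k := y)) i) = (\<Sum>i\<in>S. h i)"
        "(\<Sum>i\<in>insert k S. (h(k := y)) i) = y + (\<Sum>i\<in>S. h i)" if "S \<in> Pow {..<k}" for S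
    proof -
      have "k \<notin> S" "finite S" using that by (auto intro: finite_subset)
      then show "(\<Sum>i\<in>S. (h(k := y)) i) = (\<Sum>i\<in>S. h i)"
        by (intro sum.cong) auto
      then show "(\<Sum>i\<in>insert k S. (h(k := y)) i) = y + (\<Sum>i\<in>S. h i)"
        using \<open>k \<notin> S\<close> \<open>finite S\<close> by simp
    qed
    have inj: "inj_on (insert k) (Pow {..<k})"
      by (rule inj_onI) (metis PowD insert_ident lessThan_iff less_irrefl subsetD)
    have "(\<Prod>S\<in>Pow {..<Suc k}. g ((x + (\<Sum>i\<in>S. (h(k := y)) i)) mod int M))
      = (\<Prod>S\<in>Pow {..<k}. g ((x + (\<Sum>i\<in>S. (h(k := y)) i)) mod int M)) *
        (\<Prod>S\<in>insert k ` Pow {..<k}. g ((x + (\<Sum>i\<in>S. (h(k := y)) i)) mod int M))"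
      unfolding lessThan_Suc Pow_insert by (rule prod.union_disjoint) auto
    also have "\<dots> = P h x * P h (x + y)"
      unfolding P_def prod.reindex[OF inj] o_def
      by (intro arg_cong2[where f = "(*)"] prod.cong refl) (simp_all only: * add.assoc)
    finally show ?thesis .
  qed
  have shift: "(\<Sum>y\<in>{0..<int M}. P h (x + y)) = (\<Sum>y\<in>{0..<int M}. P h y)" for h x
    using sum.reindex_bij_betw[OF bij_betw_add_mod, of "int M" "P h" x] assms by (simp add: P_mod)
  have PiE_Suc: "(\<Sum>h\<in>PiE {..<Suc k} T. F h) = (\<Sum>h\<in>PiE {..<k} T. \<Sum>y\<in>T k. F (h(k := y)))"
    for F :: "(nat \<Rightarrow> int) \<Rightarrow> real" and T
    unfolding lessThan_Suc by (rule sum_PiE_insert) simp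
  have "gowers_sum (Suc k) M g = (\<Sum>x\<in>{0..<int M}. \<Sum>h\<in>PiE {..<k} (\<lambda>_. {0..<int M}).
      \<Sum>y\<in>{0..<int M}. P h x * P h (x + y))"
    unfolding gowers_sum_def PiE_Suc split ..
  also have "\<dots> = (\<Sum>x\<in>{0..<int M}. \<Sum>h\<in>PiE {..<k} (\<lambda>_. {0..<int M}).
      P h x * (\<Sum>y\<in>{0..<int M}. P h y))"
    by (simp add: sum_distrib_left[symmetric] shift)
  also have "\<dots> = (\<Sum>h\<in>PiE {..<k} (\<lambda>_. {0..<int M}). (\<Sum>y\<in>{0..<int M}. P h y)\<^sup>2)"
    by (subst sum.swap) (simp add: sum_distrib_right[symmetric] power2_eq_square)
  also have "\<dots> \<ge> 0" by (intro sum_nonneg) auto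
  finally show ?thesis .
qed

text \<open>Fix a direction \<open>j\<close> in \<open>S\<close> and all coordinates of
  \<open>h\<close> except \<open>h j\<close>. As \<open>h j\<close> varies, the vertex visits every
  residue exactly once, so at most \<open>card Q\<close> values are admissible; the other
  \<open>k - 1\<close> coordinates are free.\<close>

lemma card_vertex_in_le:
  assumes M: "0 < M" and S: "S \<subseteq> {..<k}" "S \<noteq> {}" and Q: "finite Q"
  shows "real (card {h \<in> PiE {..<k} (\<lambda>_. {0..<int M}). (x + (\<Sum>i\<in>S. h i)) mod int M \<in> Q})
    \<le> real (card Q) * real M ^ (k - 1)"
proof -
  obtain j where j: "j \<in> S" using S by auto
  let ?I = "{..<k} - {j}"
  have I: "{..<k} = insert j ?I" "finite S" "j \<in> {..<k}"
    using j S by (auto intro: finite_subset)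
  have le: "(\<Sum>y\<in>{0..<int M}. of_bool ((a + y) mod int M \<in> Q)) \<le> real (card Q)" for a
  proof -
    have "(\<Sum>y\<in>{0..<int M}. of_bool ((a + y) mod int M \<in> Q) :: real)
        = (\<Sum>y\<in>{0..<int M}. of_bool (y \<in> Q))"
      using M by (intro sum.reindex_bij_betw[OF bij_betw_add_mod]) simp
    also have "\<dots> = real (card {y \<in> {0..<int M}. y \<in> Q})" by (rule sum_of_bool_card) simp
    also have "\<dots> \<le> real (card Q)" using Q by (intro of_nat_mono card_mono) auto
    finally show ?thesis .
  qed
  have upd: "(\<Sum>i\<in>S. (h(j := y)) i) = (\<Sum>i\<in>S - {j}. h i) + y" for h :: "nat \<Rightarrow> int" and y
  proof -
    have "(\<Sum>i\<in>S. (h(j := y)) i) = y + (\<Sum>i\<in>S - {j}. (h(j := y)) i)"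
      using j I by (subst sum.remove[of S j]) auto
    also have "(\<Sum>i\<in>S - {j}. (h(j := y)) i) = (\<Sum>i\<in>S - {j}. h i)"
      by (intro sum.cong) auto
    finally show ?thesis by simp
  qed
  have "real (card {h \<in> PiE {..<k} (\<lambda>_. {0..<int M}). (x + (\<Sum>i\<in>S. h i)) mod int M \<in> Q})
      = (\<Sum>h\<in>PiE {..<k} (\<lambda>_. {0..<int M}). of_bool ((x + (\<Sum>i\<in>S. h i)) mod int M \<in> Q))"
    by (subst sum_of_bool_card) (simp_all add: finite_PiE)
  also have "\<dots> = (\<Sum>h\<in>PiE ?I (\<lambda>_. {0..<int M}). \<Sum>y\<in>{0..<int M}.
      of_bool ((x + (\<Sum>i\<in>S - {j}. h i) + y) mod int M \<in> Q))"
  proof -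
    have "(\<Sum>h\<in>PiE {..<k} T. F h) = (\<Sum>h\<in>PiE ?I T. \<Sum>y\<in>T j. F (h(j := y)))"
      for F :: "(nat \<Rightarrow> int) \<Rightarrow> real" and T
      by (subst I(1), rule sum_PiE_insert) simp
    then show ?thesis by (simp only: upd add.assoc)
  qed
  also have "\<dots> \<le> (\<Sum>h\<in>PiE ?I (\<lambda>_. {0..<int M}). real (card Q))"
    by (intro sum_mono le)
  also have "\<dots> = real (card Q) * real M ^ (k - 1)"
    using I(3) by (simp add: card_PiE card_Diff_singleton)
  finally show ?thesis .
qed

section \<open>Random block signs and their expected Gowers sum\<close>

text \<open>A set \<open>A\<close> of blocks encodes one outcome of the random signs, so an
  expectation becomes a sum over \<open>Pow B\<close> divided by \<open>2 ^ card B\<close>.\<close>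

definition block_sign :: "int set \<Rightarrow> int \<Rightarrow> real" where
  "block_sign A b = (if b \<in> A then - 1 else 1)"

text \<open>Each \<open>A\<close> avoiding \<open>p\<close> cancels against
  \<open>insert p A\<close>. In probabilistic terms, an expression that is odd in the sign of block
  \<open>p\<close> has mean zero.\<close>

lemma sum_Pow_flip_eq_0:
  fixes \<Phi> :: "int set \<Rightarrow> real"
  assumes "p \<in> B" "finite B" and flip: "\<And>A. A \<subseteq> B \<Longrightarrow> p \<notin> A \<Longrightarrow> \<Phi> (insert p A) = - \<Phi> A"
  shows "(\<Sum>A\<in>Pow B. \<Phi> A) = 0"
proof -
  have B: "B = insert p (B - {p})" using assms by auto
  have inj: "inj_on (insert p) (Pow (B - {p}))"
    by (rule inj_onI) (metis Diff_iff PowD insert_ident singletonI subsetD)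
  have "(\<Sum>A\<in>Pow B. \<Phi> A) = (\<Sum>A\<in>Pow (B - {p}). \<Phi> A) + (\<Sum>A\<in>insert p ` Pow (B - {p}). \<Phi> A)"
    by (subst B, subst Pow_insert, rule sum.union_disjoint) (use assms in auto)
  also have "\<dots> = (\<Sum>A\<in>Pow (B - {p}). \<Phi> A + \<Phi> (insert p A))"
    by (simp add: sum.reindex[OF inj] sum.distrib)
  also have "\<dots> = 0" by (intro sum.neutral ballI, subst flip) auto
  finally show ?thesis .
qed

text \<open>Orthogonality of independent signs. The block \<open>q\<close> may lie outside
  \<open>B\<close>, where its sign is constantly 1; this covers predicted blocks that do not meet
  \<open>[N]\<close>.\<close>

lemma sum_block_sign_mult:
  assumes "p \<in> B" "finite B"
  shows "(\<Sum>A\<in>Pow B. block_sign A p * block_sign A q) = 2 ^ card B * of_bool (p = q)"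
proof (cases "p = q")
  case True
  have "block_sign A q * block_sign A q = 1" for A by (simp add: block_sign_def)
  with True show ?thesis using assms by (simp add: card_Pow)
next
  case False
  have "(\<Sum>A\<in>Pow B. block_sign A p * block_sign A q) = 0"
    using False by (intro sum_Pow_flip_eq_0[OF assms]) (auto simp: block_sign_def)
  with False show ?thesis by simp
qed

text \<open>Only cubes whose base vertex shares its block with another vertex contribute. There are
  \<open>M\<close> base vertices and fewer than \<open>2 ^ k\<close> choices of the other vertex. A
  block has at most \<open>l\<close> points, so \<open>card_vertex_in_le\<close> leaves at most
  \<open>l * M ^ (k - 1)\<close> values of \<open>h\<close> for each choice.\<close>

lemma sum_gowers_sum_block_sign_le:
  fixes N M k :: nat and l :: int
  assumes M: "0 < M" and l: "0 < l" and k: "0 < k"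
    and B: "finite B" "\<And>x. 1 \<le> x \<Longrightarrow> x \<le> int N \<Longrightarrow> x div l \<in> B"
  shows "(\<Sum>A\<in>Pow B. gowers_sum k M (\<lambda>x. if 1 \<le> x \<and> x \<le> int N then block_sign A (x div l) else 0))
    \<le> 2 ^ card B * (2 ^ k * of_int l * real M ^ k)"
proof -
  define g where "g A x = (if 1 \<le> x \<and> x \<le> int N then block_sign A (x div l) else 0)" for A x
  define v where "v x h S = (x + (\<Sum>i\<in>S. h i)) mod int M" for x :: int and h :: "nat \<Rightarrow> int" and S
  define Q where "Q x = {y \<in> {1..int N}. y div l = x div l}" for x
  let ?H = "PiE {..<k} (\<lambda>_. {0..<int M})"
  let ?P = "Pow {..<k} - {{}}"
  have v0: "v x h {} = x" if "x \<in> {0..<int M}" for x h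
    using that by (simp add: v_def)
  have g_le: "\<bar>g A x\<bar> \<le> 1" for A x by (simp add: g_def block_sign_def)
  have finQ: "finite (Q x)" for x
    unfolding Q_def by (rule finite_subset[of _ "{1..int N}"]) auto
  have cardQ: "real (card (Q x)) \<le> of_int l" for x
  proof -
    have "Q x \<subseteq> {(x div l) * l..<(x div l) * l + l}"
    proof
      fix y assume "y \<in> Q x"
      then have "y div l = x div l" by (simp add: Q_def)
      moreover have "y = (y div l) * l + y mod l" "0 \<le> y mod l" "y mod l < l" using l by auto
      ultimately show "y \<in> {(x div l) * l..<(x div l) * l + l}" by (metis atLeastLessThan_iff le_add_same_cancel1 add_strict_left_mono)
    qed
    then have "card (Q x) \<le> card {(x div l) * l..<(x div l) * l + l}" by (intro card_mono) auto
    then have "card (Q x) \<le> nat l" by simp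
    then show ?thesis using l by linarith
  qed
  \<comment> \<open>If no other vertex shares the block of \<open>x\<close>, flipping the sign of that block negates the product.\<close>
  have point: "(\<Sum>A\<in>Pow B. \<Prod>S\<in>Pow {..<k}. g A (v x h S))
      \<le> 2 ^ card B * (\<Sum>S\<in>?P. of_bool (v x h S \<in> Q x))" if x: "x \<in> {0..<int M}" for x h
  proof (cases "\<exists>S\<in>?P. v x h S \<in> Q x")
    case True
    then obtain S where S: "S \<in> ?P" "v x h S \<in> Q x" by blast
    have "(1::real) \<le> (\<Sum>S\<in>?P. of_bool (v x h S \<in> Q x))"
      using member_le_sum[OF S(1), of "\<lambda>S. of_bool (v x h S \<in> Q x) :: real"] S(2) by simp
    moreover have "(\<Sum>A\<in>Pow B. \<Prod>S\<in>Pow {..<k}. g A (v x h S)) \<le> (\<Sum>A\<in>Pow B. 1)"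
    proof (rule sum_mono)
      fix A
      have "\<bar>\<Prod>S\<in>Pow {..<k}. g A (v x h S)\<bar> \<le> 1"
        unfolding abs_prod by (intro prod_le_1) (use g_le in auto)
      then show "(\<Prod>S\<in>Pow {..<k}. g A (v x h S)) \<le> 1" by linarith
    qed
    moreover have "(\<Sum>A\<in>Pow B. 1) = (2 ^ card B :: real)" using B by (simp add: card_Pow)
    ultimately show ?thesis
      by (metis (no_types, lifting) mult.right_neutral mult_left_mono order_trans zero_le_numeral zero_le_power)
  next
    case False
    have "(\<Sum>A\<in>Pow B. \<Prod>S\<in>Pow {..<k}. g A (v x h S)) = 0"
    proof (cases "1 \<le> x \<and> x \<le> int N")
      case True
      show ?thesis
      proof (rule sum_Pow_flip_eq_0)
        show "x div l \<in> B" using True B by auto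
        fix A assume A: "A \<subseteq> B" "x div l \<notin> A"
        have prod: "(\<Prod>S\<in>Pow {..<k}. g A' (v x h S)) = g A' x * (\<Prod>S\<in>?P. g A' (v x h S))" for A'
          using v0[OF x] by (subst prod.remove[of _ "{}"]) auto
        have "g (insert (x div l) A) (v x h S) = g A (v x h S)" if "S \<in> ?P" for S
        proof -
          have "v x h S \<notin> Q x" using False that by blast
          then show ?thesis by (auto simp: g_def Q_def block_sign_def)
        qed
        then show "(\<Prod>S\<in>Pow {..<k}. g (insert (x div l) A) (v x h S)) = - (\<Prod>S\<in>Pow {..<k}. g A (v x h S))"
          using A True unfolding prod by (simp add: g_def[of _ x] block_sign_def)
      qed (use B in auto)
    next
      case False
      have "(\<Prod>S\<in>Pow {..<k}. g A (v x h S)) = 0" for A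
        using v0[OF x] False by (subst prod.remove[of _ "{}"]) (auto simp: g_def[of _ x])
      then show ?thesis by (intro sum.neutral ballI)
    qed
    then show ?thesis by (simp add: sum_nonneg)
  qed
  have "(\<Sum>A\<in>Pow B. gowers_sum k M (g A))
      = (\<Sum>x\<in>{0..<int M}. \<Sum>h\<in>?H. \<Sum>A\<in>Pow B. \<Prod>S\<in>Pow {..<k}. g A (v x h S))"
    unfolding gowers_sum_def v_def by (subst sum.swap) (rule sum.cong[OF refl], rule sum.swap)
  also have "\<dots> \<le> (\<Sum>x\<in>{0..<int M}. \<Sum>h\<in>?H. 2 ^ card B * (\<Sum>S\<in>?P. of_bool (v x h S \<in> Q x)))"
    by (intro sum_mono point)
  also have "\<dots> = 2 ^ card B * (\<Sum>x\<in>{0..<int M}. \<Sum>S\<in>?P. \<Sum>h\<in>?H. of_bool (v x h S \<in> Q x))"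
    unfolding sum_distrib_left by (intro sum.cong refl sum.swap)
  also have "\<dots> \<le> 2 ^ card B * (\<Sum>x\<in>{0..<int M}. \<Sum>S\<in>?P. of_int l * real M ^ (k - 1))"
  proof (intro mult_left_mono sum_mono)
    fix x S assume "S \<in> ?P"
    then have S: "S \<subseteq> {..<k}" "S \<noteq> {}" by auto
    have "(\<Sum>h\<in>?H. of_bool (v x h S \<in> Q x)) = real (card {h \<in> ?H. v x h S \<in> Q x})"
      by (rule sum_of_bool_card) (simp add: finite_PiE)
    also have "\<dots> \<le> real (card (Q x)) * real M ^ (k - 1)"
      unfolding v_def by (rule card_vertex_in_le[OF M S], rule finQ)
    also have "\<dots> \<le> of_int l * real M ^ (k - 1)"
      using cardQ by (intro mult_right_mono) auto
    finally show "(\<Sum>h\<in>?H. of_bool (v x h S \<in> Q x)) \<le> of_int l * real M ^ (k - 1)" .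
  qed auto
  also have "\<dots> = 2 ^ card B * (real (card ?P) * of_int l * real M ^ k)"
    using k by (cases k) (auto simp: algebra_simps)
  also have "\<dots> \<le> 2 ^ card B * (2 ^ k * of_int l * real M ^ k)"
  proof -
    have "card ?P \<le> card (Pow {..<k})" by (intro card_mono) auto
    then have "real (card ?P) \<le> 2 ^ k" by (simp add: card_Pow flip: of_nat_le_iff)
    then show ?thesis using l by (intro mult_left_mono mult_right_mono) auto
  qed
  finally show ?thesis unfolding g_def .
qed

section \<open>Cubes inside an interval, and meeting two requirements with one choice of
  signs\<close>

text \<open>With \<open>q = N div (k + 1)\<close>, a base point in \<open>[1, q]\<close> and steps
  in \<open>[0, q)\<close> keep all vertices in \<open>[N]\<close>, without wrapping around modulo
  \<open>M\<close>. The remaining cubes contribute nonnegative terms.\<close>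

lemma gowers_sum_indicator_ge:
  fixes N M k :: nat
  assumes "N < M"
  shows "real (N div (k + 1)) ^ (k + 1) \<le> gowers_sum k M (\<lambda>x. if 1 \<le> x \<and> x \<le> int N then 1 else 0)"
proof -
  define q where "q = N div (k + 1)"
  define g :: "int \<Rightarrow> real" where "g x = (if 1 \<le> x \<and> x \<le> int N then 1 else 0)" for x
  have qN: "(k + 1) * q \<le> N" unfolding q_def by (rule times_div_less_eq_dividend)
  then have "q \<le> N" by (simp add: algebra_simps)
  have g0: "0 \<le> g x" for x by (simp add: g_def)
  have "real q ^ (k + 1) = (\<Sum>x\<in>{1..int q}. \<Sum>h\<in>PiE {..<k} (\<lambda>_. {0..<int q}). 1)"
    by (simp add: card_PiE)
  also have "\<dots> = (\<Sum>x\<in>{1..int q}. \<Sum>h\<in>PiE {..<k} (\<lambda>_. {0..<int q}).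
      \<Prod>S\<in>Pow {..<k}. g ((x + (\<Sum>i\<in>S. h i)) mod int M))"
  proof (intro sum.cong refl)
    fix x h assume x: "x \<in> {1..int q}" and h: "h \<in> PiE {..<k} (\<lambda>_. {0..<int q})"
    have "g ((x + (\<Sum>i\<in>S. h i)) mod int M) = 1" if "S \<in> Pow {..<k}" for S
    proof -
      have hb: "0 \<le> h i \<and> h i \<le> int q" if "i \<in> S" for i
        using h that \<open>S \<in> _\<close> by (force simp: PiE_iff)
      have "(\<Sum>i\<in>S. h i) \<le> of_nat (card S) * int q" by (rule sum_bounded_above) (use hb in auto)
      also have "card S \<le> k" using that card_mono[of "{..<k}" S] by auto
      then have "of_nat (card S) * int q \<le> int k * int q" by (intro mult_right_mono) auto
      finally have "(\<Sum>i\<in>S. h i) \<le> int k * int q" .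
      moreover have "0 \<le> (\<Sum>i\<in>S. h i)" using hb by (intro sum_nonneg) auto
      moreover have "int q + int k * int q \<le> int N"
        using qN by (simp add: algebra_simps flip: of_nat_mult of_nat_add)
      ultimately have "1 \<le> x + (\<Sum>i\<in>S. h i)" "x + (\<Sum>i\<in>S. h i) \<le> int N"
        using x by auto
      then show ?thesis using assms by (simp add: g_def)
    qed
    then show "1 = (\<Prod>S\<in>Pow {..<k}. g ((x + (\<Sum>i\<in>S. h i)) mod int M))" by simp
  qed
  also have "\<dots> \<le> (\<Sum>x\<in>{1..int q}. \<Sum>h\<in>PiE {..<k} (\<lambda>_. {0..<int M}).
      \<Prod>S\<in>Pow {..<k}. g ((x + (\<Sum>i\<in>S. h i)) mod int M))"
    using \<open>q \<le> N\<close> assms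
    by (intro sum_mono sum_mono2 finite_PiE PiE_mono prod_nonneg) (auto simp: g0)
  also have "\<dots> \<le> gowers_sum k M g"
    unfolding gowers_sum_def using \<open>q \<le> N\<close> assms
    by (intro sum_mono2 sum_nonneg prod_nonneg) (auto simp: g0)
  finally show ?thesis by (simp add: q_def g_def[abs_def])
qed

text \<open>Both requirements are read off from one quantity,
  \<open>t A / T - g A / (4 * \<eta>)\<close>, whose mean is at least 1/2 - 1/4. Where it reaches
  1/4, the bounds \<open>t A \<le> T\<close> and \<open>0 \<le> g A\<close> separate the two
  claims.\<close>

lemma exists_large_and_small:
  fixes t g :: "'a \<Rightarrow> real"
  assumes P: "finite P" "P \<noteq> {}" and pos: "0 < T" "0 < \<eta>"
    and t: "\<And>A. A \<in> P \<Longrightarrow> t A \<le> T" "real (card P) * (T / 2) \<le> (\<Sum>A\<in>P. t A)"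
    and g: "\<And>A. A \<in> P \<Longrightarrow> 0 \<le> g A" "(\<Sum>A\<in>P. g A) \<le> real (card P) * \<eta>"
  shows "\<exists>A\<in>P. T / 4 \<le> t A \<and> g A \<le> 4 * \<eta>"
proof -
  have "\<exists>A\<in>P. 1 / 4 \<le> t A / T - g A / (4 * \<eta>)"
  proof (rule ccontr)
    assume "\<not> ?thesis"
    then have "(\<Sum>A\<in>P. t A / T - g A / (4 * \<eta>)) < (\<Sum>A\<in>P. 1 / 4)"
      using P by (intro sum_strict_mono) (auto simp: not_le)
    then have "(\<Sum>A\<in>P. t A) / T - (\<Sum>A\<in>P. g A) / (4 * \<eta>) < real (card P) / 4"
      by (simp add: sum_subtractf sum_divide_distrib)
    moreover have "real (card P) / 2 \<le> (\<Sum>A\<in>P. t A) / T" using t(2) pos by (simp add: field_simps)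
    moreover have "(\<Sum>A\<in>P. g A) / (4 * \<eta>) \<le> real (card P) / 4" using g(2) pos by (simp add: field_simps)
    ultimately show False by linarith
  qed
  then obtain A where A: "A \<in> P" "1 / 4 \<le> t A / T - g A / (4 * \<eta>)" by blast
  have "t A / T \<le> 1" "0 \<le> g A / (4 * \<eta>)" using t(1)[OF A(1)] g(1)[OF A(1)] pos by auto
  with A(2) have "1 / 4 \<le> t A / T" "g A / (4 * \<eta>) \<le> 1" by linarith+
  then show ?thesis using A(1) pos by (auto simp: field_simps intro!: bexI[of _ A])
qed

section \<open>Distances between matrices and the consequence of near-degeneracy\<close>

text \<open>Combinations of rows stay in the form \<open>transpose A *v y\<close>, as in
  \<open>V_degen\<close>.\<close>

declare transpose_matrix_vector [simp del]

lemma abs_le_mat_linf: "\<bar>A $ i $ j\<bar> \<le> mat_linf (A :: real^'d^'m)"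
proof -
  have "{\<bar>A $ i $ j\<bar> | i j. True} = (\<lambda>(i, j). \<bar>A $ i $ j\<bar>) ` UNIV" by auto
  then show ?thesis unfolding mat_linf_def by (intro Max_ge) auto
qed

lemma mat_linf_le:
  fixes A :: "real^'d^'m"
  assumes "\<And>i j. \<bar>A $ i $ j\<bar> \<le> r"
  shows "mat_linf A \<le> r"
proof -
  have "{\<bar>A $ i $ j\<bar> | i j. True} = (\<lambda>(i, j). \<bar>A $ i $ j\<bar>) ` UNIV" by auto
  then show ?thesis unfolding mat_linf_def using assms by auto
qed

lemma mat_dist_le:
  assumes "B \<in> S"
  shows "mat_dist A S \<le> mat_linf (A - B)"
  unfolding mat_dist_def
proof (rule cInf_lower)
  have "0 \<le> mat_linf M" for M :: "real^'a^'b"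
    using abs_le_mat_linf[of M] by (meson abs_ge_zero order_trans)
  then show "bdd_below ((\<lambda>B. mat_linf (A - B)) ` S)" by (intro bdd_belowI[of _ 0]) auto
qed (use assms in auto)

text \<open>Without a member, the infimum in \<open>mat_dist\<close> would say nothing, and a small
  distance could not be turned into a nearby degenerate matrix.\<close>

lemma V_degen_nonempty: "(V_degen :: (real^'d^'m) set) \<noteq> {}"
proof -
  fix i :: 'd and k :: 'm
  let ?L = "(\<chi> _. axis i 1) :: real^'d^'m"
  have "axis i 1 - 0 *\<^sub>R axis i 1 = transpose ?L *v axis k 1"
    by (simp add: matrix_vector_mult_basis column_transpose row_def vec_lambda_eta)
  moreover have "axis i 1 - 0 *\<^sub>R axis i 1 \<noteq> (0::real^'d)" by (simp add: axis_eq_0_iff)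
  ultimately have "?L \<in> V_degen" unfolding V_degen_def by blast
  then show ?thesis by blast
qed

lemma mat_dist_lessE:
  assumes "mat_dist A S < \<eta>" "S \<noteq> {}"
  obtains B where "B \<in> S" "mat_linf (A - B) < \<eta>"
  using cInf_lessD[of "(\<lambda>B. mat_linf (A - B)) ` S" \<eta>] assms by (auto simp: mat_dist_def)

lemma rank_less_of_transpose_kernel:
  fixes A :: "real^'d^'m"
  assumes "transpose A *v y = 0" "y \<noteq> 0"
  shows "rank A < CARD('m)"
proof (rule ccontr)
  assume "\<not> ?thesis"
  then have "rank (transpose A) = CARD('m)"
    using rank_bound[of A] by (simp add: rank_transpose)
  then have "inj ((*v) (transpose A))" by (simp add: full_rank_injective)
  then have "y = 0" using assms(1) by (metis injD matrix_vector_mult_0_right)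
  with assms(2) show False by simp
qed

text \<open>If \<open>L\<^sup>T y\<close> were small, then subtracting \<open>L\<^sup>T y / y\<^sub>k\<close> from the row of \<open>L\<close> at a maximal
  coordinate \<open>k\<close> of \<open>y\<close> would give a nearby matrix whose rows are dependent.\<close>
lemma mat_dist_V_rank_mult_le:
  fixes L :: "real^'d^'m"
  assumes k: "\<And>i. \<bar>y $ i\<bar> \<le> \<bar>y $ k\<bar>" and r: "\<And>j. \<bar>(transpose L *v y) $ j\<bar> \<le> r"
  shows "mat_dist L V_rank * \<bar>y $ k\<bar> \<le> r"
proof (cases "y $ k = 0")
  case True
  \<comment> \<open>Any column index yields \<open>0 \<le> r\<close>, and \<open>undefined\<close>
    serves as one.\<close>
  then show ?thesis using r[of undefined] by simp
next
  case False
  define w where "w = transpose L *v y"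
  define M where "M = (\<chi> i j. L $ i $ j - (if i = k then w $ j / y $ k else 0))"
  have "transpose M *v y = 0"
  proof (rule vec_eq_iff[THEN iffD2], rule allI)
    fix j
    have "(transpose M *v y) $ j = (\<Sum>i\<in>UNIV. L $ i $ j * y $ i - (if i = k then w $ j else 0))"
      using False by (auto simp: matrix_vector_mult_def transpose_def M_def algebra_simps intro!: sum.cong)
    also have "\<dots> = (\<Sum>i\<in>UNIV. L $ i $ j * y $ i) - w $ j"
      by (simp add: sum_subtractf)
    also have "\<dots> = 0" by (simp add: w_def matrix_vector_mult_def transpose_def)
    finally show "(transpose M *v y) $ j = 0 $ j" by simp
  qed
  then have "M \<in> V_rank"
    unfolding V_rank_def using rank_less_of_transpose_kernel[of M y] False
    by (metis mem_Collect_eq zero_index)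
  then have "mat_dist L V_rank \<le> mat_linf (L - M)" by (rule mat_dist_le)
  also have "\<dots> \<le> r / \<bar>y $ k\<bar>"
  proof (rule mat_linf_le)
    fix i j
    have "0 \<le> r" using r[of j] by linarith
    then show "\<bar>(L - M) $ i $ j\<bar> \<le> r / \<bar>y $ k\<bar>"
      using r[of j] by (auto simp: M_def w_def abs_divide divide_right_mono)
  qed
  finally show ?thesis using False by (simp add: field_simps)
qed

text \<open>A normal form. If \<open>i = j\<close>, rescaling gives a unit vector, which is the case
  \<open>lam = 0\<close> with any second index; this is where \<open>d \<ge> 2\<close> enters. If
  \<open>lam\<close> exceeds 1 in absolute value, dividing by \<open>- lam\<close> exchanges the
  roles of \<open>i\<close> and \<open>j\<close>. The resulting vector has entries of absolute value
  at most 1.\<close>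

lemma V_degenE:
  fixes A :: "real^'d^'m"
  assumes "A \<in> V_degen" and d: "2 \<le> CARD('d)"
  obtains i j lam y where "i \<noteq> j" "\<bar>lam\<bar> \<le> 1"
    "transpose A *v y = axis i 1 - lam *\<^sub>R axis j 1"
proof -
  obtain i j lam y where ij: "axis i 1 - lam *\<^sub>R axis j 1 \<noteq> (0::real^'d)"
     "transpose A *v y = axis i 1 - lam *\<^sub>R axis j 1"
    using assms(1) unfolding V_degen_def by (auto simp: image_iff)
  consider (same) "i = j" | (small) "i \<noteq> j" "\<bar>lam\<bar> \<le> 1" | (large) "i \<noteq> j" "\<bar>lam\<bar> > 1" by linarith
  then show ?thesis
  proof cases
    case same
    obtain j' where j': "i \<noteq> j'"
      using d by (metis UNIV_I card_2_iff' card_le_Suc0_iff_eq finite not_less_eq_eq numeral_2_eq_2)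
    have lam: "lam \<noteq> 1" using ij(1) same by auto
    have eq: "transpose A *v y = (1 - lam) *\<^sub>R axis i 1"
      using ij(2) same by (simp add: algebra_simps)
    have "transpose A *v ((1 / (1 - lam)) *\<^sub>R y) = axis i 1 - 0 *\<^sub>R axis j' 1"
      using lam by (simp add: matrix_vector_mult_scaleR eq)
    with j' show ?thesis by (intro that[of i j' 0]) auto
  next
    case small
    then show ?thesis using ij by (intro that) auto
  next
    case large
    have "transpose A *v ((- 1 / lam) *\<^sub>R y) = (- 1 / lam) *\<^sub>R (axis i 1 - lam *\<^sub>R axis j 1)"
      by (simp only: matrix_vector_mult_scaleR ij)
    also have "\<dots> = axis j 1 - (1 / lam) *\<^sub>R axis i 1"
      using large by (simp add: algebra_simps)
    finally show ?thesis using large by (intro that[of j i "1 / lam"]) (auto simp: abs_divide)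
  qed
qed

text \<open>Take a degenerate \<open>A\<close> near \<open>L\<close> and \<open>y\<close> with
  \<open>transpose A *v y\<close> equal to \<open>axis i 1 - lam *\<^sub>R axis j 1\<close>. The
  distance of \<open>L\<close> from \<open>V_rank\<close> bounds \<open>y\<close> by
  \<open>2 / c\<close>. Pairing with \<open>x\<close> then writes \<open>x $ i - lam * x $ j\<close>
  as the inner product of \<open>y\<close> with \<open>A *v x\<close>, which is close to
  \<open>L *v x\<close>.\<close>

lemma near_degenerate_window:
  fixes L :: "real^'d^'m"
  assumes d: "2 \<le> CARD('d)" and c: "0 < c" "c \<le> mat_dist L V_rank"
    and \<eta>: "mat_dist L V_degen < \<eta>" "real CARD('m) * \<eta> \<le> c / 2"
  shows "\<exists>i j lam. i \<noteq> j \<and> (\<forall>x N. (\<forall>r. \<bar>(L *v x) $ r\<bar> \<le> \<epsilon>) \<longrightarrow> (\<forall>l. \<bar>x $ l\<bar> \<le> N)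
    \<longrightarrow> \<bar>x $ i - lam * x $ j\<bar> \<le> real CARD('m) * (2 / c) * (\<epsilon> + real CARD('d) * \<eta> * N))"
proof -
  obtain A :: "real^'d^'m" where A: "A \<in> V_degen" "mat_linf (L - A) < \<eta>"
    using mat_dist_lessE[OF \<eta>(1) V_degen_nonempty] .
  have entry: "\<bar>L $ r $ l - A $ r $ l\<bar> \<le> \<eta>" for r l
    using abs_le_mat_linf[of "L - A" r l] A(2) by simp
  obtain i j lam y where ij: "i \<noteq> j" "\<bar>lam\<bar> \<le> 1"
    and y: "transpose A *v y = axis i 1 - lam *\<^sub>R axis j 1"
    using V_degenE[OF A(1) d] .
  have "Max (range (\<lambda>r. \<bar>y $ r\<bar>)) \<in> range (\<lambda>r. \<bar>y $ r\<bar>)" by (intro Max_in) auto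
  then obtain k where "\<bar>y $ k\<bar> = Max (range (\<lambda>r. \<bar>y $ r\<bar>))" by (auto simp: image_iff)
  then have k: "\<bar>y $ r\<bar> \<le> \<bar>y $ k\<bar>" for r by simp
  have "\<bar>(transpose L *v y) $ l\<bar> \<le> 1 + real CARD('m) * \<eta> * \<bar>y $ k\<bar>" for l
  proof -
    have "(transpose L *v y) $ l = (transpose A *v y) $ l + (\<Sum>r\<in>UNIV. (L $ r $ l - A $ r $ l) * y $ r)"
      by (simp add: matrix_vector_mult_def transpose_def algebra_simps sum_subtractf)
    moreover have "\<bar>(transpose A *v y) $ l\<bar> \<le> 1"
      using ij by (auto simp: y axis_def)
    moreover have "\<bar>\<Sum>r\<in>UNIV. (L $ r $ l - A $ r $ l) * y $ r\<bar> \<le> (\<Sum>r\<in>(UNIV::'m set). \<eta> * \<bar>y $ k\<bar>)"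
      by (intro order_trans[OF sum_abs] sum_mono) (auto simp: abs_mult intro!: mult_mono entry k order_trans[OF abs_ge_zero entry])
    ultimately show ?thesis by (simp add: mult.assoc)
  qed
  then have "mat_dist L V_rank * \<bar>y $ k\<bar> \<le> 1 + real CARD('m) * \<eta> * \<bar>y $ k\<bar>"
    by (rule mat_dist_V_rank_mult_le[OF k])
  moreover have "c * \<bar>y $ k\<bar> \<le> mat_dist L V_rank * \<bar>y $ k\<bar>" using c by (intro mult_right_mono) auto
  \<comment> \<open>The error from replacing \<open>A\<close> by \<open>L\<close> is absorbed into
    half of the left-hand side, leaving \<open>c / 2 * \<bar>y $ k\<bar> \<le> 1\<close>.\<close>
  moreover have "real CARD('m) * \<eta> * \<bar>y $ k\<bar> \<le> c / 2 * \<bar>y $ k\<bar>" using \<eta> by (intro mult_right_mono) auto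
  ultimately have "c * \<bar>y $ k\<bar> \<le> 2" by linarith
  then have yk: "\<bar>y $ k\<bar> \<le> 2 / c" using c by (simp add: field_simps)
  show ?thesis
  proof (rule exI[of _ i], rule exI[of _ j], rule exI[of _ lam], intro conjI ij(1) allI impI)
    fix x :: "real^'d" and N
    assume "\<forall>r. \<bar>(L *v x) $ r\<bar> \<le> \<epsilon>" and "\<forall>l. \<bar>x $ l\<bar> \<le> N"
    then have Lx: "\<And>r. \<bar>(L *v x) $ r\<bar> \<le> \<epsilon>" and x: "\<And>l. \<bar>x $ l\<bar> \<le> N" by blast+
    have Ax: "\<bar>(A *v x) $ r\<bar> \<le> \<epsilon> + real CARD('d) * \<eta> * N" for r
    proof -
      have "(A *v x) $ r = (L *v x) $ r - (\<Sum>l\<in>UNIV. (L $ r $ l - A $ r $ l) * x $ l)"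
        by (simp add: matrix_vector_mult_def algebra_simps sum_subtractf)
      moreover have "\<bar>\<Sum>l\<in>UNIV. (L $ r $ l - A $ r $ l) * x $ l\<bar> \<le> (\<Sum>l\<in>(UNIV::'d set). \<eta> * N)"
        by (intro order_trans[OF sum_abs] sum_mono) (auto simp: abs_mult intro!: mult_mono entry x order_trans[OF abs_ge_zero entry])
      ultimately show ?thesis using Lx[of r] by (simp add: mult.assoc)
    qed
    have "x $ i - lam * x $ j = (axis i 1 - lam *\<^sub>R axis j 1) \<bullet> x"
      by (simp add: inner_diff_left inner_axis_axis inner_axis' )
    also have "\<dots> = y \<bullet> (A *v x)" by (simp add: dot_lmul_matrix[symmetric] transpose_matrix_vector flip: y)
    also have "\<dots> = (\<Sum>r\<in>UNIV. y $ r * (A *v x) $ r)" by (simp add: inner_vec_def)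
    finally have "\<bar>x $ i - lam * x $ j\<bar> \<le> (\<Sum>r\<in>UNIV. \<bar>y $ r * (A *v x) $ r\<bar>)"
      by (metis sum_abs)
    also have "\<dots> \<le> (\<Sum>r\<in>(UNIV::'m set). (2 / c) * (\<epsilon> + real CARD('d) * \<eta> * N))"
      unfolding abs_mult by (intro sum_mono mult_mono Ax order_trans[OF k yk]) (use c in auto)
    finally have "\<bar>x $ i - lam * x $ j\<bar> \<le> (\<Sum>r\<in>(UNIV::'m set). (2 / c) * (\<epsilon> + real CARD('d) * \<eta> * N))" .
    then show "\<bar>x $ i - lam * x $ j\<bar> \<le> real CARD('m) * (2 / c) * (\<epsilon> + real CARD('d) * \<eta> * N)"
      by (simp add: mult.assoc)
  qed
qed

section \<open>From Gowers sums to the norm on an interval\<close>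

text \<open>A lower bound for the normalised number of \<open>k\<close>-cubes inside \<open>[N]\<close>, relative to all \<open>k\<close>-cubes modulo
  \<open>2 ^ (k + 1) * N\<close>.\<close>
definition gowers_density :: "nat \<Rightarrow> real" where
  "gowers_density k = (1 / (2 ^ (k + 2) * real (k + 1))) ^ (k + 1)"

lemma gowers_density_pos: "0 < gowers_density k"
  unfolding gowers_density_def by (intro zero_less_power divide_pos_pos mult_pos_pos) auto

text \<open>The normalising sum is at least \<open>gowers_density k\<close> times
  \<open>M ^ (k + 1)\<close>, so the quotient under the root is at most
  \<open>\<rho> ^ (2 ^ k)\<close>.\<close>

lemma gowers_interval_le:
  assumes k: "0 < k" and N: "k + 1 \<le> N" and \<rho>: "0 < \<rho>" and M: "M = 2 ^ (k + 1) * N"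
    and f: "gowers_sum k M (\<lambda>x. if 1 \<le> x \<and> x \<le> int N then f x else 0)
      \<le> gowers_density k * \<rho> ^ (2 ^ k) * real M ^ (k + 1)"
  shows "gowers_interval k N f \<le> \<rho>"
proof -
  define X where "X = gowers_sum k M (\<lambda>x. if 1 \<le> x \<and> x \<le> int N then f x else 0) / real M ^ (k + 1)"
  define D where "D = gowers_sum k M (\<lambda>x. if 1 \<le> x \<and> x \<le> int N then 1 else 0) / real M ^ (k + 1)"
  have "0 < N" using N by simp
  then have M0: "0 < M" by (simp add: M)
  have X: "X \<le> gowers_density k * \<rho> ^ (2 ^ k)"
    using f M0 by (simp add: X_def divide_le_eq del: power_Suc)
  have "0 \<le> X" using gowers_sum_nonneg[OF M0, of "k - 1"] k by (simp add: X_def)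
  have "N < M"
  proof -
    have "N * 1 < N * 2 ^ (k + 1)" using \<open>0 < N\<close> one_less_power[of "2::nat" "k + 1"]
      by (intro mult_strict_left_mono) auto
    then show ?thesis by (simp add: M mult.commute)
  qed
  \<comment> \<open>As \<open>k + 1 \<le> N\<close>, the integer quotient is at least 1, and
    rounding down loses at most a factor 2.\<close>
  have "real N / (2 * real (k + 1)) \<le> real (N div (k + 1))"
  proof -
    have "N < (k + 1) * (N div (k + 1)) + (k + 1)"
      using mult_div_mod_eq[of "k + 1" N] mod_less_divisor[of "k + 1" N] by linarith
    moreover have "1 \<le> N div (k + 1)" using N by (simp add: div_greater_zero_iff Suc_le_eq del: add_Suc_right)
    then have "k + 1 \<le> (k + 1) * (N div (k + 1))" by (metis mult.right_neutral mult_le_mono2)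
    ultimately have "N \<le> 2 * ((k + 1) * (N div (k + 1)))" by linarith
    then have "real N \<le> 2 * (real (k + 1) * real (N div (k + 1)))"
      by (metis of_nat_le_iff of_nat_mult of_nat_numeral)
    then show ?thesis by (simp add: divide_le_eq algebra_simps)
  qed
  \<comment> \<open>The exponent \<open>k + 2\<close> combines \<open>M / N = 2 ^ (k + 1)\<close>
    with the factor 2 lost in rounding.\<close>
  moreover have "1 / (2 ^ (k + 2) * real (k + 1)) = real N / (2 * real (k + 1)) / real M"
  proof -
    have "1 / (2 ^ (k + 2) * K) = n / (2 * K) / (2 ^ (k + 1) * n)" if "n \<noteq> 0" for n K :: real
      using that by simp
    from this[of "real N" "real (k + 1)"] show ?thesis using \<open>0 < N\<close> by (simp add: M)
  qed
  ultimately have "1 / (2 ^ (k + 2) * real (k + 1)) \<le> real (N div (k + 1)) / real M"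
    by (simp only: divide_right_mono of_nat_0_le_iff)
  then have "gowers_density k \<le> (real (N div (k + 1)) / real M) ^ (k + 1)"
    unfolding gowers_density_def by (intro power_mono) auto
  also have "\<dots> \<le> D"
    unfolding D_def power_divide by (intro divide_right_mono gowers_sum_indicator_ge \<open>N < M\<close>) simp
  finally have D: "gowers_density k \<le> D" .
  then have "0 < D" using gowers_density_pos[of k] by linarith
  have "X \<le> D * \<rho> ^ (2 ^ k)"
    using X D \<rho> by (meson mult_right_mono order_trans zero_le_power less_imp_le)
  then have "X / D \<le> \<rho> ^ (2 ^ k)" using \<open>0 < D\<close> by (simp add: divide_le_eq mult.commute)
  have "gowers_interval k N f = (X / D) powr (1 / 2 ^ k)"
    using \<open>0 \<le> X\<close> \<open>0 < D\<close>
    by (simp add: gowers_interval_def gowers_cyc_eq X_def D_def M powr_divide)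
  also have "\<dots> \<le> (\<rho> ^ (2 ^ k)) powr (1 / 2 ^ k)"
    using \<open>X / D \<le> _\<close> \<open>0 \<le> X\<close> \<open>0 < D\<close> by (intro powr_mono2) auto
  also have "\<dots> = \<rho>"
    using \<rho> by (simp add: powr_powr flip: powr_realpow)
  finally show ?thesis .
qed

section \<open>Solution counts of block-sign functions\<close>

text \<open>The term of \<open>n\<close> in the count for constant functions 1, normalisation
  included. It vanishes unless all coordinates of \<open>n\<close> lie in
  \<open>[N]\<close>.\<close>

definition sol_weight ::
    "(real^'d \<Rightarrow> real) \<Rightarrow> (real^'m \<Rightarrow> real) \<Rightarrow> real^'d^'m \<Rightarrow> nat \<Rightarrow> int^'d \<Rightarrow> real" where
  "sol_weight F G L N n = 1 / real N ^ (CARD('d) - CARD('m)) *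
     ((\<Prod>j\<in>UNIV. (if 1 \<le> n $ j \<and> n $ j \<le> int N then 1 else 0)) * F (real_ivec n) * G (L *v real_ivec n))"

lemma sol_count_two_functions:
  fixes F :: "real^'d \<Rightarrow> real" and G :: "real^'m \<Rightarrow> real"
  assumes "i \<noteq> j"
  shows "sol_count F G L N (\<lambda>l. if l = i then u else if l = j then v else (\<lambda>_. 1))
    = (\<Sum>n\<in>{n. \<forall>j. \<bar>n $ j\<bar> \<le> int N}. u (n $ i) * v (n $ j) * sol_weight F G L N n)"
proof -
  have "(\<Prod>l\<in>UNIV. (if 1 \<le> n $ l \<and> n $ l \<le> int N
          then (if l = i then u else if l = j then v else (\<lambda>_. 1)) (n $ l) else 0))
      = u (n $ i) * v (n $ j) * (\<Prod>l\<in>UNIV. (if 1 \<le> n $ l \<and> n $ l \<le> int N then 1 else 0))"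
    for n :: "int^'d"
  proof (cases "\<forall>l. 1 \<le> n $ l \<and> n $ l \<le> int N")
    case True
    have "(\<Prod>l\<in>UNIV. (if l = i then u else if l = j then v else (\<lambda>_. 1)) (n $ l))
        = (\<Prod>l\<in>UNIV. (if l = i then u (n $ i) else 1) * (if l = j then v (n $ j) else 1))"
      using assms by (intro prod.cong) auto
    also have "\<dots> = u (n $ i) * v (n $ j)" by (simp add: prod.distrib)
    finally show ?thesis using True by simp
  next
    case False
    then show ?thesis by (subst (1 2) prod_zero) auto
  qed
  then show ?thesis
    by (simp only: sol_count_def sol_weight_def sum_distrib_left mult_ac)
qed

text \<open>Here \<open>lo (n $ j)\<close> predicts the first of two candidate blocks for
  \<open>n $ i\<close>. By orthogonality, the mean count is exactly the weight of the solutions for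
  which the prediction \<open>lo (n $ j) + a\<close> is right, and \<open>a\<close> is 0 or 1 so
  that this is at least \<open>T / 2\<close>. The remaining factors come from
  \<open>exists_large_and_small\<close>.\<close>

lemma exists_block_sign_functions:
  fixes F :: "real^'d \<Rightarrow> real" and G :: "real^'m \<Rightarrow> real" and lo :: "int \<Rightarrow> int"
  assumes pos: "0 < M" "0 < k" "0 < l" and ij: "i \<noteq> j"
    and F: "\<And>x. 0 \<le> F x" and G: "\<And>y. 0 \<le> G y"
    and window: "\<And>n. F (real_ivec n) * G (L *v real_ivec n) \<noteq> 0
      \<Longrightarrow> n $ i div l = lo (n $ j) \<or> n $ i div l = lo (n $ j) + 1"
    and T: "0 < T" "T = sol_count F G L N (\<lambda>_ _. 1)"
  shows "\<exists>f. (\<forall>j x. \<bar>f j x\<bar> \<le> 1) \<and> T / 4 \<le> sol_count F G L N f \<and>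
    gowers_sum k M (\<lambda>x. if 1 \<le> x \<and> x \<le> int N then f i x else 0) \<le> 4 * (2 ^ k * of_int l * real M ^ k)"
proof -
  define B where "B = (\<lambda>x. x div l) ` {1..int N}"
  have B: "finite B" "\<And>x. 1 \<le> x \<Longrightarrow> x \<le> int N \<Longrightarrow> x div l \<in> B" by (auto simp: B_def)
  define w where "w = sol_weight F G L N"
  let ?Z = "{n :: int^'d. \<forall>j. \<bar>n $ j\<bar> \<le> int N}"
  have w0: "0 \<le> w n" for n
    unfolding w_def sol_weight_def by (intro mult_nonneg_nonneg prod_nonneg F G) auto
  \<comment> \<open>Orthogonality needs the true block of \<open>n $ i\<close> to carry one of the
    random signs; terms of weight zero drop out anyway.\<close>
  have wi: "n $ i div l \<in> B" if "w n \<noteq> 0" for n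
  proof (rule ccontr)
    assume "n $ i div l \<notin> B"
    then have "\<not> (1 \<le> n $ i \<and> n $ i \<le> int N)" using B by blast
    then have "(\<Prod>j\<in>UNIV. (if 1 \<le> n $ j \<and> n $ j \<le> int N then 1 else 0 :: real)) = 0"
      by (intro prod_zero) auto
    with that show False by (simp add: w_def sol_weight_def)
  qed
  define t where "t a = (\<Sum>n\<in>?Z. of_bool (n $ i div l = lo (n $ j) + a) * w n)" for a
  define f where "f a A = (\<lambda>h. if h = i then (\<lambda>x. block_sign A (x div l))
    else if h = j then (\<lambda>x. block_sign A (lo x + a)) else (\<lambda>_. 1))" for a A
  have count: "sol_count F G L N (f a A) =
      (\<Sum>n\<in>?Z. block_sign A (n $ i div l) * block_sign A (lo (n $ j) + a) * w n)" for a A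
    unfolding f_def w_def by (rule sol_count_two_functions[OF ij])
  have T_eq: "T = (\<Sum>n\<in>?Z. w n)"
  proof -
    have "(\<lambda>h. if h = i then (\<lambda>_. 1) else if h = j then (\<lambda>_. 1) else (\<lambda>_. 1)) = (\<lambda>(_::'d) (_::int). 1::real)"
      by auto
    then show ?thesis
      using sol_count_two_functions[OF ij, of F G L N "\<lambda>_. 1" "\<lambda>_. 1"] T(2) by (simp add: w_def)
  qed
  also have "\<dots> \<le> t 0 + t 1"
    unfolding t_def sum.distrib[symmetric]
  proof (rule sum_mono)
    fix n
    have "F (real_ivec n) * G (L *v real_ivec n) \<noteq> 0" if "w n \<noteq> 0"
      using that by (auto simp: w_def sol_weight_def)
    then show "w n \<le> of_bool (n $ i div l = lo (n $ j) + 0) * w n + of_bool (n $ i div l = lo (n $ j) + 1) * w n"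
      using window[of n] w0[of n] by (cases "w n = 0") auto
  qed
  finally obtain a where a: "T / 2 \<le> t a" by (metis add_strict_mono field_sum_of_halves not_le)
  have sum_count: "(\<Sum>A\<in>Pow B. sol_count F G L N (f a A)) = 2 ^ card B * t a"
  proof -
    have "(\<Sum>A\<in>Pow B. block_sign A (n $ i div l) * block_sign A (lo (n $ j) + a) * w n)
        = 2 ^ card B * (of_bool (n $ i div l = lo (n $ j) + a) * w n)" for n
      using sum_block_sign_mult[OF wi B(1), of n "lo (n $ j) + a"]
      by (cases "w n = 0") (simp_all flip: sum_distrib_right)
    then show ?thesis unfolding count t_def by (subst sum.swap) (simp add: sum_distrib_left)
  qed
  have "\<exists>A\<in>Pow B. T / 4 \<le> sol_count F G L N (f a A) \<and>
    gowers_sum k M (\<lambda>x. if 1 \<le> x \<and> x \<le> int N then block_sign A (x div l) else 0)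
      \<le> 4 * (2 ^ k * of_int l * real M ^ k)"
  proof (rule exists_large_and_small)
    show "sol_count F G L N (f a A) \<le> T" for A
      unfolding count T_eq
    proof (rule sum_mono)
      fix n show "block_sign A (n $ i div l) * block_sign A (lo (n $ j) + a) * w n \<le> w n"
        using w0[of n] by (auto simp: block_sign_def)
    qed
    show "real (card (Pow B)) * (T / 2) \<le> (\<Sum>A\<in>Pow B. sol_count F G L N (f a A))"
      unfolding sum_count using a B(1) by (simp add: card_Pow)
    show "0 \<le> gowers_sum k M (\<lambda>x. if 1 \<le> x \<and> x \<le> int N then block_sign A (x div l) else 0)" for A
      using gowers_sum_nonneg[OF pos(1), of "k - 1"] pos(2) by simp
    show "(\<Sum>A\<in>Pow B. gowers_sum k M (\<lambda>x. if 1 \<le> x \<and> x \<le> int N then block_sign A (x div l) else 0))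
      \<le> real (card (Pow B)) * (2 ^ k * of_int l * real M ^ k)"
      using sum_gowers_sum_block_sign_le[OF pos(1,3,2) B] B(1) by (simp add: card_Pow)
    show "0 < 2 ^ k * of_int l * real M ^ k" using pos by simp
  qed (use B T in auto)
  then obtain A where A: "T / 4 \<le> sol_count F G L N (f a A)"
    "gowers_sum k M (\<lambda>x. if 1 \<le> x \<and> x \<le> int N then block_sign A (x div l) else 0)
      \<le> 4 * (2 ^ k * of_int l * real M ^ k)" by blast
  have fi: "f a A i = (\<lambda>x. block_sign A (x div l))" by (simp add: f_def)
  have "\<bar>f a A h x\<bar> \<le> 1" for h x by (simp add: f_def block_sign_def)
  then show ?thesis using A by (intro exI[of _ "f a A"] conjI allI) (unfold fi)
qed

section \<open>Windows and blocks, choice of parameters, and conclusion\<close>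

text \<open>The window \<open>[z - W, z + W]\<close> is no longer than a block, so it meets only the
  block of its left end and the next one.\<close>

lemma div_window:
  fixes x l :: int
  assumes "0 < l" "\<bar>real_of_int x - z\<bar> \<le> W" "2 * W \<le> of_int l"
  shows "x div l = \<lfloor>(z - W) / of_int l\<rfloor> \<or> x div l = \<lfloor>(z - W) / of_int l\<rfloor> + 1"
proof -
  have "z - W \<le> of_int x" "of_int x \<le> (z - W) + of_int l" using assms by linarith+
  then have "(z - W) / of_int l \<le> of_int x / of_int l" "of_int x / of_int l \<le> (z - W) / of_int l + 1"
    using assms(1) by (simp_all add: divide_right_mono divide_le_eq add_divide_distrib distrib_right)
  then have "\<lfloor>(z - W) / of_int l\<rfloor> \<le> \<lfloor>of_int x / (of_int l :: real)\<rfloor>"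
    "\<lfloor>of_int x / (of_int l :: real)\<rfloor> \<le> \<lfloor>(z - W) / of_int l\<rfloor> + 1"
    by linarith+
  then show ?thesis by (auto simp: floor_divide_of_int_eq)
qed

theorem theorem2p12:
  fixes L :: "nat \<Rightarrow> real^'d^'m"
    and \<epsilon> c C :: real
    and s :: nat
    and H :: "real \<Rightarrow> real"
    and E :: "real \<Rightarrow> nat \<Rightarrow> real"
  assumes dim: "CARD('d) \<ge> CARD('m) + 2"
    and pos: "\<epsilon> > 0" "c > 0" "C > 0"
    and Lbound: "\<forall>N. mat_linf (L N) \<le> C"
    and Lrank: "\<forall>N. mat_dist (L N) V_rank \<ge> c"
    and Tlower: "\<exists>\<kappa>>0. \<forall>\<^sub>F N in sequentially.
        sol_count (indicator {x. \<forall>j. 1 \<le> x $ j \<and> x $ j \<le> real N})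
                  (indicator {y. \<forall>i. \<bar>y $ i\<bar> \<le> \<epsilon>}) (L N) N (\<lambda>j x. 1) \<ge> \<kappa>"
    and degen: "liminf (\<lambda>N. ereal (mat_dist (L N) V_degen)) = 0"
    and Hpos: "\<forall>\<rho>>0. H \<rho> > 0"
    and Hlim: "(H \<longlongrightarrow> 0) (at_right 0)"
    and Elim: "\<forall>\<rho>>0. (E \<rho> \<longlongrightarrow> 0) sequentially"
  shows "\<exists>\<^sub>\<infinity>N. \<exists>f :: 'd \<Rightarrow> int \<Rightarrow> real.
           (\<forall>j. \<forall>x\<in>{1..int N}. \<bar>f j x\<bar> \<le> 1) \<and>
           (\<exists>\<rho>. 0 < \<rho> \<and> \<rho> \<le> 1 \<and>
              Min (range (\<lambda>j. gowers_interval (s + 1) N (f j))) \<le> \<rho> \<and>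
              \<bar>sol_count (indicator {x. \<forall>j. 1 \<le> x $ j \<and> x $ j \<le> real N})
                         (indicator {y. \<forall>i. \<bar>y $ i\<bar> \<le> \<epsilon>}) (L N) N f\<bar> > H \<rho> + E \<rho> N)"
proof -
  define F :: "nat \<Rightarrow> real^'d \<Rightarrow> real" where "F N = indicator {x. \<forall>j. 1 \<le> x $ j \<and> x $ j \<le> real N}" for N
  define G :: "real^'m \<Rightarrow> real" where "G = indicator {y. \<forall>i. \<bar>y $ i\<bar> \<le> \<epsilon>}"
  define k where "k = s + 1"
  define m d where "m = real CARD('m)" and "d = real CARD('d)"
  have md: "0 < m" "0 < d" by (simp_all add: m_def d_def)
  obtain \<kappa> where \<kappa>: "0 < \<kappa>" "\<forall>\<^sub>F N in sequentially. \<kappa> \<le> sol_count (F N) G (L N) N (\<lambda>j x. 1)"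
    using Tlower unfolding F_def G_def by auto
  \<comment> \<open>The constructed functions have count at least \<open>\<kappa> / 4\<close>, so
    \<open>H \<rho>\<close> and the error term may each take up to
    \<open>\<kappa> / 8\<close>.\<close>
  have "\<forall>\<^sub>F \<rho> in at_right 0. H \<rho> < \<kappa> / 8" using order_tendstoD(2)[OF Hlim, of "\<kappa> / 8"] \<kappa> by simp
  moreover have "\<forall>\<^sub>F \<rho> in at_right (0::real). 0 < \<rho> \<and> \<rho> < 1"
    using eventually_at_right_real[of 0 1] by simp
  ultimately have "\<forall>\<^sub>F \<rho> in at_right 0. H \<rho> < \<kappa> / 8 \<and> 0 < \<rho> \<and> \<rho> < 1" by (rule eventually_conj)
  then obtain \<rho> where \<rho>: "H \<rho> < \<kappa> / 8" "0 < \<rho>" "\<rho> < 1"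
    using eventually_happens[of _ "at_right (0::real)"] by (auto simp: trivial_limit_at_right_real)
  \<comment> \<open>With \<open>M = 2 ^ (k + 1) * N\<close>, this makes
    \<open>4 * 2 ^ k * (\<beta> * N) * M ^ k\<close> equal to the bound required by
    \<open>gowers_interval_le\<close>.\<close>
  define \<beta> where "\<beta> = gowers_density k * \<rho> ^ (2 ^ k) / 2"
  have \<beta>: "0 < \<beta>" using gowers_density_pos[of k] \<rho> by (simp add: \<beta>_def)
  \<comment> \<open>The first bound is the smallness required by
    \<open>near_degenerate_window\<close>; the second keeps the part of the window proportional to
    \<open>N\<close> below \<open>\<beta> * N / 16\<close>.\<close>
  define \<eta> where "\<eta> = min (c / (2 * m)) (\<beta> * c / (32 * m * d))"
  have \<eta>: "0 < \<eta>" "m * \<eta> \<le> c / 2" "m * (2 / c) * (d * \<eta>) \<le> \<beta> / 16"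
  proof -
    show "0 < \<eta>" using pos md \<beta> by (simp add: \<eta>_def)
    have "\<eta> \<le> c / (2 * m)" "\<eta> \<le> \<beta> * c / (32 * m * d)" by (simp_all add: \<eta>_def)
    then show "m * \<eta> \<le> c / 2" "m * (2 / c) * (d * \<eta>) \<le> \<beta> / 16"
      using pos md by (simp_all add: field_simps)
  qed
  \<comment> \<open>The liminf supplies only infinitely many \<open>N\<close>, hence
    \<open>frequently\<close>; every other condition holds eventually and is intersected with
    it.\<close>
  have freq: "\<exists>\<^sub>F N in sequentially. mat_dist (L N) V_degen < \<eta>"
  proof (rule ccontr)
    assume "\<not> ?thesis"
    then have "\<forall>\<^sub>F N in sequentially. ereal \<eta> \<le> ereal (mat_dist (L N) V_degen)"
      by (simp add: frequently_def not_less)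
    then have "ereal \<eta> \<le> liminf (\<lambda>N. ereal (mat_dist (L N) V_degen))" by (rule Liminf_bounded)
    with degen \<eta>(1) show False by simp
  qed
  have "\<forall>\<^sub>F N in sequentially. E \<rho> N < \<kappa> / 8"
    using order_tendstoD(2)[OF Elim[rule_format, OF \<rho>(2)], of "\<kappa> / 8"] \<kappa> by simp
  \<comment> \<open>The first condition keeps the block length at least
    \<open>\<beta> * N / 2\<close> after rounding down; the second bounds the
    \<open>\<epsilon>\<close> part of the window by \<open>\<beta> * N / 16\<close>.\<close>
  moreover have "\<forall>\<^sub>F N in sequentially. 2 / \<beta> \<le> real N"
    "\<forall>\<^sub>F N in sequentially. m * (2 / c) * \<epsilon> / (\<beta> / 16) \<le> real N"
    using filterlim_real_sequentially by (simp_all only: filterlim_at_top)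
  moreover have "\<forall>\<^sub>F N in sequentially. k + 1 \<le> N" by (rule eventually_ge_at_top)
  ultimately have "\<forall>\<^sub>F N in sequentially. \<kappa> \<le> sol_count (F N) G (L N) N (\<lambda>j x. 1) \<and> E \<rho> N < \<kappa> / 8 \<and>
      2 / \<beta> \<le> real N \<and> m * (2 / c) * \<epsilon> / (\<beta> / 16) \<le> real N \<and> k + 1 \<le> N"
    using \<kappa>(2) by eventually_elim auto
  with freq have "\<exists>\<^sub>F N in sequentially. mat_dist (L N) V_degen < \<eta> \<and>
      \<kappa> \<le> sol_count (F N) G (L N) N (\<lambda>j x. 1) \<and> E \<rho> N < \<kappa> / 8 \<and>
      2 / \<beta> \<le> real N \<and> m * (2 / c) * \<epsilon> / (\<beta> / 16) \<le> real N \<and> k + 1 \<le> N"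
    by (rule frequently_eventually_frequently)
  then have "\<exists>\<^sub>F N in sequentially. \<exists>f. (\<forall>j. \<forall>x\<in>{1..int N}. \<bar>f j x\<bar> \<le> 1) \<and>
           (\<exists>\<rho>. 0 < \<rho> \<and> \<rho> \<le> 1 \<and> Min (range (\<lambda>j. gowers_interval (s + 1) N (f j))) \<le> \<rho> \<and>
              \<bar>sol_count (F N) G (L N) N f\<bar> > H \<rho> + E \<rho> N)"
  proof (rule frequently_elim1, elim conjE)
    fix N
    assume near: "mat_dist (L N) V_degen < \<eta>"
      and count: "\<kappa> \<le> sol_count (F N) G (L N) N (\<lambda>j x. 1)"
      and E: "E \<rho> N < \<kappa> / 8"
      and N: "2 / \<beta> \<le> real N" "m * (2 / c) * \<epsilon> / (\<beta> / 16) \<le> real N" "k + 1 \<le> N"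
    define M where "M = 2 ^ (k + 1) * N"
    define l where "l = \<lfloor>\<beta> * real N\<rfloor>"
    define W where "W = m * (2 / c) * (\<epsilon> + d * \<eta> * real N)"
    have N0: "0 < N" using N(3) by simp
    have M0: "0 < M" using N0 by (simp add: M_def)
    have "2 \<le> \<beta> * real N" using N(1) \<beta> by (simp add: field_simps)
    then have l: "0 < l" "of_int l \<le> \<beta> * real N" "\<beta> * real N / 2 \<le> of_int l"
      unfolding l_def by linarith+
    \<comment> \<open>Both parts of \<open>W\<close> are at most \<open>\<beta> * N / 16\<close>, so
      \<open>2 * W \<le> \<beta> * N / 4\<close>, below the block length.\<close>
    have W: "2 * W \<le> of_int l"
    proof -
      have "m * (2 / c) * \<epsilon> \<le> \<beta> / 16 * real N" using N(2) \<beta>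
        by (subst mult.commute, subst pos_divide_le_eq[symmetric]) auto
      moreover have "m * (2 / c) * (d * \<eta>) * real N \<le> \<beta> / 16 * real N"
        using \<eta>(3) by (rule mult_right_mono) simp
      moreover have "W = m * (2 / c) * \<epsilon> + m * (2 / c) * (d * \<eta>) * real N"
        unfolding W_def by (simp only: distrib_left mult.assoc)
      ultimately have "W \<le> \<beta> / 8 * real N" by linarith
      moreover have "0 < \<beta> * real N" using \<beta> N0 by simp
      ultimately show ?thesis using l(3) by simp
    qed
    have d2: "2 \<le> CARD('d)" using dim by linarith
    have m\<eta>: "real CARD('m) * \<eta> \<le> c / 2" using \<eta>(2) by (simp add: m_def)
    obtain i j :: 'd and lam where ij: "i \<noteq> j" and
      close: "\<forall>x R. (\<forall>r. \<bar>(L N *v x) $ r\<bar> \<le> \<epsilon>) \<longrightarrow> (\<forall>h. \<bar>x $ h\<bar> \<le> R)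
        \<longrightarrow> \<bar>x $ i - lam * x $ j\<bar> \<le> m * (2 / c) * (\<epsilon> + d * \<eta> * R)"
      using near_degenerate_window[OF d2 pos(2) Lrank[rule_format] near m\<eta>, of \<epsilon>]
      unfolding m_def d_def by blast
    \<comment> \<open>This is the block containing the left end of the window around
      \<open>lam * y\<close>, where \<open>y\<close> stands for the value of
      \<open>n $ j\<close>.\<close>
    define lo where "lo y = \<lfloor>(lam * of_int y - W) / of_int l\<rfloor>" for y :: int
    have "\<exists>f. (\<forall>j x. \<bar>f j x\<bar> \<le> 1) \<and>
        sol_count (F N) G (L N) N (\<lambda>_ _. 1) / 4 \<le> sol_count (F N) G (L N) N f \<and>
        gowers_sum k M (\<lambda>x. if 1 \<le> x \<and> x \<le> int N then f i x else 0) \<le> 4 * (2 ^ k * of_int l * real M ^ k)"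
    proof (rule exists_block_sign_functions[where lo = lo and j = j])
      fix n assume "F N (real_ivec n) * G (L N *v real_ivec n) \<noteq> 0"
      then have "\<forall>r. \<bar>(L N *v real_ivec n) $ r\<bar> \<le> \<epsilon>" "\<forall>h. 1 \<le> real_ivec n $ h \<and> real_ivec n $ h \<le> real N"
        by (simp_all add: F_def G_def indicator_def split: if_splits)
      then have n: "\<bar>(L N *v real_ivec n) $ r\<bar> \<le> \<epsilon>"
        "1 \<le> real_ivec n $ h \<and> real_ivec n $ h \<le> real N" for r h
        by blast+
      have abs_n: "\<bar>real_ivec n $ h\<bar> \<le> real N" for h using n(2)[of h] by linarith
      have "\<bar>real_ivec n $ i - lam * real_ivec n $ j\<bar> \<le> W"
        unfolding W_def by (rule close[rule_format, OF n(1) abs_n])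
      then have "\<bar>real_of_int (n $ i) - lam * of_int (n $ j)\<bar> \<le> W" by (simp add: real_ivec_def)
      then show "n $ i div l = lo (n $ j) \<or> n $ i div l = lo (n $ j) + 1"
        unfolding lo_def by (rule div_window[OF l(1) _ W])
    qed (use M0 l ij count \<kappa> in \<open>auto simp: k_def F_def G_def\<close>)
    then obtain f where f: "\<And>j x. \<bar>f j x\<bar> \<le> 1"
      "sol_count (F N) G (L N) N (\<lambda>_ _. 1) / 4 \<le> sol_count (F N) G (L N) N f"
      "gowers_sum k M (\<lambda>x. if 1 \<le> x \<and> x \<le> int N then f i x else 0) \<le> 4 * (2 ^ k * of_int l * real M ^ k)"
      by blast
    have "4 * (2 ^ k * of_int l * real M ^ k) \<le> 4 * (2 ^ k * (\<beta> * real N) * real M ^ k)"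
      using l(2) by (intro mult_left_mono mult_right_mono) auto
    also have "\<dots> = gowers_density k * \<rho> ^ (2 ^ k) * real M ^ (k + 1)"
      by (simp add: \<beta>_def M_def)
    finally have "gowers_interval k N (f i) \<le> \<rho>"
      using f(3) by (intro gowers_interval_le[OF _ N(3) \<rho>(2) M_def]) (auto simp: k_def)
    moreover have "Min (range (\<lambda>j. gowers_interval k N (f j))) \<le> gowers_interval k N (f i)"
      by (rule Min_le) auto
    ultimately have "Min (range (\<lambda>j. gowers_interval k N (f j))) \<le> \<rho>" by linarith
    moreover have "H \<rho> + E \<rho> N < \<bar>sol_count (F N) G (L N) N f\<bar>"
      using f(2) count E \<rho>(1) by linarith
    ultimately show "\<exists>f. (\<forall>j. \<forall>x\<in>{1..int N}. \<bar>f j x\<bar> \<le> 1) \<and>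
           (\<exists>\<rho>. 0 < \<rho> \<and> \<rho> \<le> 1 \<and> Min (range (\<lambda>j. gowers_interval (s + 1) N (f j))) \<le> \<rho> \<and>
              \<bar>sol_count (F N) G (L N) N f\<bar> > H \<rho> + E \<rho> N)"
      using f(1) \<rho> by (intro exI[of _ f] conjI exI[of _ \<rho>]) (auto simp: k_def)
  qed
  then show ?thesis unfolding F_def G_def by (simp only: cofinite_eq_sequentially)
qed

end
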